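(* Let $\Gamma>0$ be an ordinal, $\mathcal{M}=(W,R,V)$ a Kripke model, $w_0\in W$ and $\varphi_0$ a sentence of the modal $\mu$-calculus. Then $\mathcal{M},w_0\vDash^\Gamma\varphi_0$ (truth under $\Gamma$-bounded compositional semantics) if and only if $\mathcal{M},w_0\Vdash^\Gamma\varphi_0$ (truth under $\Gamma$-bounded game-theoretic semantics).
   Context: Formulae of the modal $\mu$-calculus over proposition symbols $\Phi$ and label symbols $\Lambda$: $\varphi ::= p \mid \neg p \mid X \mid \varphi\vee\varphi \mid \varphi\wedge\varphi \mid \Diamond\varphi \mid \Box\varphi \mid \mu X\varphi \mid \nu X\varphi$. $\mathrm{Sub}(\varphi)$: nodes of the syntax tree (occurrences distinguished); $\mathrm{Sub}_{\mu\nu}(\varphi)$: those of form $\mu X\psi$ or $\nu X\psi$. A sentence has no free label occurrences. For an occurrence of $X$ in a sentence $\varphi_0$, $\mathrm{rf}(X)$ is the nearest ancestor in the syntax tree of the form $\mu X\psi$ or $\nu X\psi$. Kripke model $\mathcal{M}=(W,R,V)$, $W\ne\emptyset$, $R\subseteq W^2$, $V:\Phi\to\mathcal{P}(W)$; an assignment is $s:\Lambda\to\mathcal{P}(W)$. Approximants: for $F:\mathcal{P}(W)\to\mathcal{P}(W)$, $F^0_\mu=\emptyset$, $F^0_\nu=W$; $F^\gamma_\mu=F(F^{\gamma-1}_\mu)$, $F^\gamma_\nu=F(F^{\gamma-1}_\nu)$ for successor $\gamma$; $F^\gamma_\mu=\bigcup_{\delta<\gamma}F^\delta_\mu$, $F^\gamma_\nu=\bigcap_{\delta<\gamma}F^\delta_\nu$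 for limit $\gamma$. $\Gamma$-bounded compositional semantics $\mathcal{M},w\vDash^\Gamma_s\varphi$: literals, $\vee,\wedge$, $\Diamond$, $\Box$ as in modal logic; $\mathcal{M},w\vDash^\Gamma_s X$ iff $w\in s(X)$; $\mathcal{M},w\vDash^\Gamma_s\mu X\psi$ iff $w\in (F_{\psi,X,s,\Gamma})^\Gamma_\mu$ and $\mathcal{M},w\vDash^\Gamma_s\nu X\psi$ iff $w\in (F_{\psi,X,s,\Gamma})^\Gamma_\nu$, where $F_{\psi,X,s,\Gamma}(A)=\{v\in W\mid \mathcal{M},v\vDash^\Gamma_{s[A/X]}\psi\}$ and $s[A/X]$ maps $X$ to $A$ and agrees with $s$ elsewhere. For sentences truth is independent of $s$ and written $\mathcal{M},w\vDash^\Gamma\varphi$. $\Gamma$-bounded evaluation game $(\mathcal{M},w_0,\varphi_0,\Gamma)$: players Eloise and Abelard; positions $(w,\varphi,c)$ with $w\in W$, $\varphi\in\mathrm{Sub}(\varphi_0)$, $c:\mathrm{Sub}_{\mu\nu}(\varphi_0)\to\{\gamma\mid\gamma\le\Gamma\}$; initial position $(w_0,\varphi_0,c_0)$ with $c_0\equiv\Gamma$. At $(w,p,c)$ Eloise wins iff $w\in V(p)$ (else Abelard wins); at $(w,\neg p,c)$ Eloise wins iff $w\notin V(p)$ (else Abelard wins); at $\psi\vee\theta$ Eloise picks a disjunct, at $\psi\wedge\theta$ Abelard picks a conjunct (same $w,c$); at $\Diamond\psi$ Eloise picks an $R$-successor $v$ and play goes to $(v,\psi,c)$, Abelard winning if none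 exists; at $\Box\psi$ Abelard picks an $R$-successor, Eloise winning if none exists; at $(w,\mu X\psi,c)$ Eloise chooses $\gamma<\Gamma$ and play goes to $(w,\psi,c[\gamma/\mu X\psi])$; at $(w,\nu X\psi,c)$ Abelard chooses $\gamma<\Gamma$ likewise. At $(w,X,c)$ with $\gamma=c(\mathrm{rf}(X))$: if $\mathrm{rf}(X)=\mu X\psi$, Abelard wins if $\gamma=0$, else Eloise chooses $\gamma'<\gamma$ and play goes to $(w,\psi,c')$ with $c'(\mu X\psi)=\gamma'$, $c'(\theta)=\Gamma$ for all $\theta\in\mathrm{Sub}_{\mu\nu}(\varphi_0)$ inside $\psi$, and $c'(\theta)=c(\theta)$ otherwise; if $\mathrm{rf}(X)=\nu X\psi$, the same with Eloise and Abelard swapped. A strategy for Eloise assigns her a legal choice at each position where she moves; it is winning if she wins every play in which she follows it. $\mathcal{M},w_0\Vdash^\Gamma\varphi_0$ iff Eloise has a winning strategy in $(\mathcal{M},w_0,\varphi_0,\Gamma)$. *)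

theory Defs
  imports "HOL-Library.Sublist" "HOL-Library.FuncSet"
begin

section \<open>Syntax\<close>

datatype ('p, 'x) fm =
    Prop 'p
  | NProp 'p
  | Var 'x
  | Or "('p, 'x) fm" "('p, 'x) fm"
  | And "('p, 'x) fm" "('p, 'x) fm"
  | Dia "('p, 'x) fm"
  | Box "('p, 'x) fm"
  | Mu 'x "('p, 'x) fm"
  | Nu 'x "('p, 'x) fm"

primrec free_labels :: "('p, 'x) fm \<Rightarrow> 'x set" where
  "free_labels (Prop p) = {}"
| "free_labels (NProp p) = {}"
| "free_labels (Var X) = {X}"
| "free_labels (Or \<phi> \<psi>) = free_labels \<phi> \<union> free_labels \<psi>"
| "free_labels (And \<phi> \<psi>) = free_labels \<phi> \<union> free_labels \<psi>"
| "free_labels (Dia \<phi>) = free_labels \<phi>"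
| "free_labels (Box \<phi>) = free_labels \<phi>"
| "free_labels (Mu X \<phi>) = free_labels \<phi> - {X}"
| "free_labels (Nu X \<phi>) = free_labels \<phi> - {X}"

definition sentence :: "('p, 'x) fm \<Rightarrow> bool" where
  "sentence \<phi> \<longleftrightarrow> free_labels \<phi> = {}"

text \<open>
  Occurrences of subformulae are nodes of the syntax tree. A node is given by its address, the
  list of child indices on the way from the root, so \<open>n @ [i]\<close> is the \<open>i\<close>-th child of \<open>n\<close>, and
  ancestors are prefixes.
\<close>

type_synonym node = "nat list"

primrec children :: "('p, 'x) fm \<Rightarrow> ('p, 'x) fm list" where
  "children (Prop p) = []"
| "children (NProp p) = []"
| "children (Var X) = []"
| "children (Or \<phi> \<psi>) = [\<phi>, \<psi>]"
| "children (And \<phi> \<psi>) = [\<phi>, \<psi>]"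
| "children (Dia \<phi>) = [\<phi>]"
| "children (Box \<phi>) = [\<phi>]"
| "children (Mu X \<phi>) = [\<phi>]"
| "children (Nu X \<phi>) = [\<phi>]"

fun subfm_at :: "('p, 'x) fm \<Rightarrow> node \<Rightarrow> ('p, 'x) fm option" where
  "subfm_at \<phi> [] = Some \<phi>"
| "subfm_at \<phi> (i # n) =
     (if i < length (children \<phi>) then subfm_at (children \<phi> ! i) n else None)"

definition Sub :: "('p, 'x) fm \<Rightarrow> node set" where
  "Sub \<phi> = {n. subfm_at \<phi> n \<noteq> None}"

definition mu_at :: "('p, 'x) fm \<Rightarrow> node \<Rightarrow> 'x \<Rightarrow> bool" where
  "mu_at \<phi> n X \<longleftrightarrow> (\<exists>\<psi>. subfm_at \<phi> n = Some (Mu X \<psi>))"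

definition nu_at :: "('p, 'x) fm \<Rightarrow> node \<Rightarrow> 'x \<Rightarrow> bool" where
  "nu_at \<phi> n X \<longleftrightarrow> (\<exists>\<psi>. subfm_at \<phi> n = Some (Nu X \<psi>))"

definition Sub_munu :: "('p, 'x) fm \<Rightarrow> node set" where
  "Sub_munu \<phi> = {n. \<exists>X. mu_at \<phi> n X \<or> nu_at \<phi> n X}"

text \<open>
  \<open>rf \<phi> n X\<close> is meaningful when \<open>n\<close> is an occurrence of the label \<open>X\<close> that is bound in \<open>\<phi>\<close>; it is
  the nearest ancestor of \<open>n\<close> that binds \<open>X\<close>.
\<close>

definition rf :: "('p, 'x) fm \<Rightarrow> node \<Rightarrow> 'x \<Rightarrow> node" where
  "rf \<phi> n X = (THE r. strict_prefix r n \<and> (mu_at \<phi> r X \<or> nu_at \<phi> r X) \<and>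
     (\<forall>r'. strict_prefix r r' \<and> strict_prefix r' n \<longrightarrow> \<not> (mu_at \<phi> r' X \<or> nu_at \<phi> r' X)))"


section \<open>Kripke models\<close>

record ('w, 'p) kripke =
  worlds :: "'w set"
  acc :: "('w \<times> 'w) set"
  val :: "'p \<Rightarrow> 'w set"

definition kripke_model :: "('w, 'p) kripke \<Rightarrow> bool" where
  "kripke_model M \<longleftrightarrow>
     worlds M \<noteq> {} \<and> acc M \<subseteq> worlds M \<times> worlds M \<and> (\<forall>p. val M p \<subseteq> worlds M)"

definition assignment :: "('w, 'p) kripke \<Rightarrow> ('x \<Rightarrow> 'w set) \<Rightarrow> bool" where
  "assignment M s \<longleftrightarrow> (\<forall>X. s X \<subseteq> worlds M)"


section \<open>Ordinals and approximants\<close>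

text \<open>
  Ordinals are elements of an arbitrary type \<open>'o\<close> of class \<^class>\<open>wellorder\<close>, an element standing
  for the order type of its set of strict predecessors. Every ordinal \<open>\<Gamma>\<close> is so represented as
  soon as \<open>'o\<close> has order type greater than \<open>\<Gamma>\<close>, and only ordinals up to \<open>\<Gamma>\<close> are ever used.
\<close>

definition ord_zero :: "'o::wellorder" where
  "ord_zero = (LEAST \<gamma>. True)"

definition is_pred :: "'o::wellorder \<Rightarrow> 'o \<Rightarrow> bool" where
  "is_pred \<delta> \<gamma> \<longleftrightarrow> \<delta> < \<gamma> \<and> \<not> (\<exists>\<epsilon>. \<delta> < \<epsilon> \<and> \<epsilon> < \<gamma>)"

definition is_successor :: "'o::wellorder \<Rightarrow> bool" where
  "is_successor \<gamma> \<longleftrightarrow> (\<exists>\<delta>. is_pred \<delta> \<gamma>)"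

definition ord_pred :: "'o::wellorder \<Rightarrow> 'o" where
  "ord_pred \<gamma> = (THE \<delta>. is_pred \<delta> \<gamma>)"

lemma is_pred_ord_pred: "is_successor \<gamma> \<Longrightarrow> is_pred (ord_pred \<gamma>) \<gamma>"
  unfolding is_successor_def ord_pred_def
  by (rule theI') (metis is_pred_def linorder_neqE)

lemma ord_pred_less: "is_successor \<gamma> \<Longrightarrow> ord_pred \<gamma> < \<gamma>"
  using is_pred_ord_pred is_pred_def by blast

function approx_mu :: "('w set \<Rightarrow> 'w set) \<Rightarrow> 'o::wellorder \<Rightarrow> 'w set" where
  "approx_mu F \<gamma> =
     (if \<gamma> = ord_zero then {}
      else if is_successor \<gamma> then F (approx_mu F (ord_pred \<gamma>))
      else (\<Union>\<delta>\<in>{..<\<gamma>}. approx_mu F \<delta>))"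
  by pat_completeness auto
termination
  by (relation "inv_image {(\<delta>, \<gamma>). \<delta> < \<gamma>} snd") (auto simp: wf ord_pred_less)

text \<open>The first argument is the ambient set of worlds.\<close>

function approx_nu :: "'w set \<Rightarrow> ('w set \<Rightarrow> 'w set) \<Rightarrow> 'o::wellorder \<Rightarrow> 'w set" where
  "approx_nu W F \<gamma> =
     (if \<gamma> = ord_zero then W
      else if is_successor \<gamma> then F (approx_nu W F (ord_pred \<gamma>))
      else (\<Inter>\<delta>\<in>{..<\<gamma>}. approx_nu W F \<delta>))"
  by pat_completeness auto
termination
  by (relation "inv_image {(\<delta>, \<gamma>). \<delta> < \<gamma>} (snd \<circ> snd)") (auto simp: wf ord_pred_less)

text \<open>Both equations loop as rewrite rules.\<close>

declare approx_mu.simps [simp del] approx_nu.simps [simp del]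


section \<open>Bounded compositional semantics\<close>

primrec sat ::
  "('w, 'p) kripke \<Rightarrow> 'o::wellorder \<Rightarrow> ('x \<Rightarrow> 'w set) \<Rightarrow> 'w \<Rightarrow> ('p, 'x) fm \<Rightarrow> bool" where
  "sat M \<Gamma> s w (Prop p) \<longleftrightarrow> w \<in> val M p"
| "sat M \<Gamma> s w (NProp p) \<longleftrightarrow> w \<notin> val M p"
| "sat M \<Gamma> s w (Var X) \<longleftrightarrow> w \<in> s X"
| "sat M \<Gamma> s w (Or \<phi> \<psi>) \<longleftrightarrow> sat M \<Gamma> s w \<phi> \<or> sat M \<Gamma> s w \<psi>"
| "sat M \<Gamma> s w (And \<phi> \<psi>) \<longleftrightarrow> sat M \<Gamma> s w \<phi> \<and> sat M \<Gamma> s w \<psi>"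
| "sat M \<Gamma> s w (Dia \<phi>) \<longleftrightarrow> (\<exists>v. (w, v) \<in> acc M \<and> sat M \<Gamma> s v \<phi>)"
| "sat M \<Gamma> s w (Box \<phi>) \<longleftrightarrow> (\<forall>v. (w, v) \<in> acc M \<longrightarrow> sat M \<Gamma> s v \<phi>)"
| "sat M \<Gamma> s w (Mu X \<phi>) \<longleftrightarrow>
     w \<in> approx_mu (\<lambda>A. {v \<in> worlds M. sat M \<Gamma> (s(X := A)) v \<phi>}) \<Gamma>"
| "sat M \<Gamma> s w (Nu X \<phi>) \<longleftrightarrow>
     w \<in> approx_nu (worlds M) (\<lambda>A. {v \<in> worlds M. sat M \<Gamma> (s(X := A)) v \<phi>}) \<Gamma>"


section \<open>Bounded evaluation game\<close>

text \<open>
  The clock \<open>c\<close> of a position is a function on \<^term>\<open>Sub_munu \<phi>\<close> only, so outside this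
  set it takes the value \<^term>\<open>undefined\<close>.
\<close>

type_synonym ('w, 'o) position = "'w \<times> node \<times> (node \<Rightarrow> 'o)"

datatype player = Eloise | Abelard

definition positions ::
  "('w, 'p) kripke \<Rightarrow> ('p, 'x) fm \<Rightarrow> 'o::wellorder \<Rightarrow> ('w, 'o) position set" where
  "positions M \<phi> \<Gamma> = worlds M \<times> Sub \<phi> \<times> (Sub_munu \<phi> \<rightarrow>\<^sub>E {..\<Gamma>})"

definition initial_position ::
  "'w \<Rightarrow> ('p, 'x) fm \<Rightarrow> 'o::wellorder \<Rightarrow> ('w, 'o) position" where
  "initial_position w \<phi> \<Gamma> = (w, [], \<lambda>n\<in>Sub_munu \<phi>. \<Gamma>)"

text \<open>The player who has to choose at a node; \<^term>\<open>None\<close> at literals.\<close>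

definition mover :: "('p, 'x) fm \<Rightarrow> node \<Rightarrow> player option" where
  "mover \<phi> n =
     (case subfm_at \<phi> n of
        Some (Or _ _) \<Rightarrow> Some Eloise
      | Some (And _ _) \<Rightarrow> Some Abelard
      | Some (Dia _) \<Rightarrow> Some Eloise
      | Some (Box _) \<Rightarrow> Some Abelard
      | Some (Mu _ _) \<Rightarrow> Some Eloise
      | Some (Nu _ _) \<Rightarrow> Some Abelard
      | Some (Var X) \<Rightarrow>
          (if mu_at \<phi> (rf \<phi> n X) X then Some Eloise
           else if nu_at \<phi> (rf \<phi> n X) X then Some Abelard
           else None)
      | _ \<Rightarrow> None)"

text \<open>
  The clock after a label bound at \<open>r\<close> has been visited and \<open>\<gamma>\<close> has been chosen: the
  fixpoint nodes inside the body \<open>r @ [0]\<close> are reset to \<open>\<Gamma>\<close>.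
\<close>

definition reset ::
  "('p, 'x) fm \<Rightarrow> 'o::wellorder \<Rightarrow> node \<Rightarrow> 'o \<Rightarrow> (node \<Rightarrow> 'o) \<Rightarrow> (node \<Rightarrow> 'o)" where
  "reset \<phi> \<Gamma> r \<gamma> c =
     (\<lambda>n. if n = r then \<gamma> else if n \<in> Sub_munu \<phi> \<and> prefix (r @ [0]) n then \<Gamma> else c n)"

text \<open>
  Different choices at a position lead to different positions, so a choice is identified with the
  position it leads to.
\<close>

fun moves ::
  "('w, 'p) kripke \<Rightarrow> ('p, 'x) fm \<Rightarrow> 'o::wellorder \<Rightarrow> ('w, 'o) position \<Rightarrow> ('w, 'o) position set"
where
  "moves M \<phi> \<Gamma> (w, n, c) =
     (case subfm_at \<phi> n of
        Some (Or _ _) \<Rightarrow> {(w, n @ [0], c), (w, n @ [1], c)}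
      | Some (And _ _) \<Rightarrow> {(w, n @ [0], c), (w, n @ [1], c)}
      | Some (Dia _) \<Rightarrow> {(v, n @ [0], c) | v. (w, v) \<in> acc M}
      | Some (Box _) \<Rightarrow> {(v, n @ [0], c) | v. (w, v) \<in> acc M}
      | Some (Mu _ _) \<Rightarrow> {(w, n @ [0], c(n := \<gamma>)) | \<gamma>. \<gamma> < \<Gamma>}
      | Some (Nu _ _) \<Rightarrow> {(w, n @ [0], c(n := \<gamma>)) | \<gamma>. \<gamma> < \<Gamma>}
      | Some (Var X) \<Rightarrow>
          (let r = rf \<phi> n X in {(w, r @ [0], reset \<phi> \<Gamma> r \<gamma>' c) | \<gamma>'. \<gamma>' < c r})
      | _ \<Rightarrow> {})"

text \<open>
  The winner at a position without moves. At a literal this depends on the valuation; at all other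
  positions (no successor, or clock value zero at a label) the player who has to move loses.
\<close>

fun eloise_wins_at :: "('w, 'p) kripke \<Rightarrow> ('p, 'x) fm \<Rightarrow> ('w, 'o) position \<Rightarrow> bool" where
  "eloise_wins_at M \<phi> (w, n, c) \<longleftrightarrow>
     (case subfm_at \<phi> n of
        Some (Prop p) \<Rightarrow> w \<in> val M p
      | Some (NProp p) \<Rightarrow> w \<notin> val M p
      | _ \<Rightarrow> mover \<phi> n = Some Abelard)"

text \<open>
  Plays are maximal. An infinite play would have no winner, so it is not won by Eloise.
\<close>

datatype 'a play = Finite "'a list" | Infinite "nat \<Rightarrow> 'a"

primrec is_play ::
  "('w, 'p) kripke \<Rightarrow> 'w \<Rightarrow> ('p, 'x) fm \<Rightarrow> 'o::wellorder \<Rightarrow> ('w, 'o) position play \<Rightarrow> bool" where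
  "is_play M w \<phi> \<Gamma> (Finite ps) \<longleftrightarrow>
     ps \<noteq> [] \<and> hd ps = initial_position w \<phi> \<Gamma> \<and>
     (\<forall>i. Suc i < length ps \<longrightarrow> ps ! Suc i \<in> moves M \<phi> \<Gamma> (ps ! i)) \<and>
     moves M \<phi> \<Gamma> (last ps) = {}"
| "is_play M w \<phi> \<Gamma> (Infinite \<pi>) \<longleftrightarrow>
     \<pi> 0 = initial_position w \<phi> \<Gamma> \<and> (\<forall>i. \<pi> (Suc i) \<in> moves M \<phi> \<Gamma> (\<pi> i))"

primrec eloise_wins_play :: "('w, 'p) kripke \<Rightarrow> ('p, 'x) fm \<Rightarrow> ('w, 'o) position play \<Rightarrow> bool" where
  "eloise_wins_play M \<phi> (Finite ps) \<longleftrightarrow> eloise_wins_at M \<phi> (last ps)"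
| "eloise_wins_play M \<phi> (Infinite \<pi>) \<longleftrightarrow> False"

definition eloise_moves :: "('p, 'x) fm \<Rightarrow> ('w, 'o) position \<Rightarrow> bool" where
  "eloise_moves \<phi> P \<longleftrightarrow> mover \<phi> (fst (snd P)) = Some Eloise"

definition strategy ::
  "('w, 'p) kripke \<Rightarrow> ('p, 'x) fm \<Rightarrow> 'o::wellorder
     \<Rightarrow> (('w, 'o) position \<Rightarrow> ('w, 'o) position) \<Rightarrow> bool" where
  "strategy M \<phi> \<Gamma> \<sigma> \<longleftrightarrow>
     (\<forall>P\<in>positions M \<phi> \<Gamma>. eloise_moves \<phi> P \<and> moves M \<phi> \<Gamma> P \<noteq> {} \<longrightarrow> \<sigma> P \<in> moves M \<phi> \<Gamma> P)"

primrec follows ::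
  "('p, 'x) fm \<Rightarrow> (('w, 'o) position \<Rightarrow> ('w, 'o) position) \<Rightarrow> ('w, 'o) position play \<Rightarrow> bool" where
  "follows \<phi> \<sigma> (Finite ps) \<longleftrightarrow>
     (\<forall>i. Suc i < length ps \<and> eloise_moves \<phi> (ps ! i) \<longrightarrow> ps ! Suc i = \<sigma> (ps ! i))"
| "follows \<phi> \<sigma> (Infinite \<pi>) \<longleftrightarrow>
     (\<forall>i. eloise_moves \<phi> (\<pi> i) \<longrightarrow> \<pi> (Suc i) = \<sigma> (\<pi> i))"

definition winning_strategy ::
  "('w, 'p) kripke \<Rightarrow> 'w \<Rightarrow> ('p, 'x) fm \<Rightarrow> 'o::wellorder
     \<Rightarrow> (('w, 'o) position \<Rightarrow> ('w, 'o) position) \<Rightarrow> bool" where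
  "winning_strategy M w \<phi> \<Gamma> \<sigma> \<longleftrightarrow>
     strategy M \<phi> \<Gamma> \<sigma> \<and>
     (\<forall>p. is_play M w \<phi> \<Gamma> p \<and> follows \<phi> \<sigma> p \<longrightarrow> eloise_wins_play M \<phi> p)"

definition game_true :: "('w, 'p) kripke \<Rightarrow> 'o::wellorder \<Rightarrow> 'w \<Rightarrow> ('p, 'x) fm \<Rightarrow> bool" where
  "game_true M \<Gamma> w \<phi> \<longleftrightarrow> (\<exists>\<sigma>. winning_strategy M w \<phi> \<Gamma> \<sigma>)"

end

theory Submission imports Defs
begin

text \<open>
  A position \<open>(w, n, c)\<close> is given a truth value: the formula at \<open>n\<close> is evaluated at \<open>w\<close>, each label
  bound at a node \<open>r\<close> above \<open>n\<close> being interpreted by the approximant with index \<open>c r\<close>. For a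
  monotone operator \<open>F\<close>, \<open>F\<^sup>\<gamma>\<close> is the union (for \<open>\<mu>\<close>) or intersection (for \<open>\<nu>\<close>) of all \<open>F (F\<^sup>\<delta>)\<close>
  with \<open>\<delta> < \<gamma>\<close>, also at limits; hence a position where Eloise (Abelard) moves is true iff some
  (every) move leads to a true position. Moreover the clock values read along the branch from the root
  to \<open>n\<close> decrease lexicographically with every move, so plays are finite, and preserving truth is
  winning for Eloise while preserving falsity refutes every strategy of hers.
\<close>

section \<open>Approximants\<close>

lemma not_less_ord_zero: "\<not> \<delta> < ord_zero"
  unfolding ord_zero_def by (simp add: Least_le leD)

lemma less_successor_iff:
  assumes "is_successor \<gamma>"
  shows "\<delta> < \<gamma> \<longleftrightarrow> \<delta> \<le> ord_pred \<gamma>"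
  using is_pred_ord_pred[OF assms] unfolding is_pred_def by (meson leI le_less_trans)

text \<open>Any \<delta> below \<gamma> has some \<epsilon> strictly between them, as otherwise
  \<delta> would be the predecessor of \<gamma>. At zero both sides are empty.\<close>

lemma lessThan_limit:
  assumes "\<not> is_successor \<gamma>"
  shows "{..<\<gamma>} = (\<Union>\<delta>\<in>{..<\<gamma>}. {..<\<delta>})"
  using assms unfolding is_successor_def is_pred_def by (auto intro: less_trans)

text \<open>Replaces the zero, successor and limit clauses by one that matches the rule "choose a
  smaller clock value". By the induction hypothesis and monotonicity the predecessor contributes the
  largest term of the union at a successor; at a limit the nested unions flatten.\<close>

lemma approx_mu_unfold:
  assumes "mono F"
  shows "approx_mu F \<gamma> = (\<Union>\<delta>\<in>{..<\<gamma>}. F (approx_mu F \<delta>))"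
proof (induction \<gamma> rule: less_induct)
  case (less \<gamma>)
  consider "\<gamma> = ord_zero" | "\<gamma> \<noteq> ord_zero" "is_successor \<gamma>" | "\<gamma> \<noteq> ord_zero" "\<not> is_successor \<gamma>"
    by blast
  then show ?case
  proof cases
    case 1
    then show ?thesis by (subst approx_mu.simps) (auto simp: not_less_ord_zero)
  next
    case 2
    have "approx_mu F \<delta> \<subseteq> approx_mu F (ord_pred \<gamma>)" if "\<delta> < \<gamma>" for \<delta>
      using that less[OF that] less[OF ord_pred_less[OF 2(2)]] less_successor_iff[OF 2(2), of \<delta>]
      by fastforce
    then have "F (approx_mu F \<delta>) \<subseteq> F (approx_mu F (ord_pred \<gamma>))" if "\<delta> < \<gamma>" for \<delta>
      using that assms by (simp add: monoD)
    with 2 show ?thesis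
      using ord_pred_less[OF 2(2)] by (auto simp: approx_mu.simps[of F \<gamma>])
  next
    case 3
    have "approx_mu F \<gamma> = (\<Union>\<delta>\<in>{..<\<gamma>}. \<Union>\<epsilon>\<in>{..<\<delta>}. F (approx_mu F \<epsilon>))"
      using 3 less by (simp add: approx_mu.simps[of F \<gamma>])
    also have "\<dots> = (\<Union>\<delta>\<in>{..<\<gamma>}. F (approx_mu F \<delta>))"
      by (subst (2) lessThan_limit[OF 3(2)]) blast
    finally show ?thesis .
  qed
qed

text \<open>The factor \<open>W\<close> gives the correct value at zero, where the intersection
  ranges over the empty family. At a successor it is absorbed because \<open>F\<close> takes values
  inside \<open>W\<close>.\<close>

lemma approx_nu_unfold:
  assumes "mono F" "\<And>A. F A \<subseteq> W"
  shows "approx_nu W F \<gamma> = W \<inter> (\<Inter>\<delta>\<in>{..<\<gamma>}. F (approx_nu W F \<delta>))"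
proof (induction \<gamma> rule: less_induct)
  case (less \<gamma>)
  consider "\<gamma> = ord_zero" | "\<gamma> \<noteq> ord_zero" "is_successor \<gamma>" | "\<gamma> \<noteq> ord_zero" "\<not> is_successor \<gamma>"
    by blast
  then show ?case
  proof cases
    case 1
    then show ?thesis by (subst approx_nu.simps) (auto simp: not_less_ord_zero)
  next
    case 2
    have "approx_nu W F (ord_pred \<gamma>) \<subseteq> approx_nu W F \<delta>" if "\<delta> < \<gamma>" for \<delta>
      using that less[OF that] less[OF ord_pred_less[OF 2(2)]] less_successor_iff[OF 2(2), of \<delta>]
      by fastforce
    then have "F (approx_nu W F (ord_pred \<gamma>)) \<subseteq> F (approx_nu W F \<delta>)" if "\<delta> < \<gamma>" for \<delta>
      using that assms(1) by (simp add: monoD)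
    with 2 show ?thesis
      using ord_pred_less[OF 2(2)] assms(2) by (auto simp: approx_nu.simps[of W F \<gamma>])
  next
    case 3
    \<comment> \<open>The index set is nonempty, so the constant factor \<open>W\<close> can be
      pulled out of the intersection below.\<close>
    have "ord_zero < \<gamma>"
      using 3(1) not_less_ord_zero[of \<gamma>] by auto
    have "approx_nu W F \<gamma> = (\<Inter>\<delta>\<in>{..<\<gamma>}. W \<inter> (\<Inter>\<epsilon>\<in>{..<\<delta>}. F (approx_nu W F \<epsilon>)))"
      using 3 less by (simp add: approx_nu.simps[of W F \<gamma>])
    also have "\<dots> = W \<inter> (\<Inter>\<delta>\<in>{..<\<gamma>}. F (approx_nu W F \<delta>))"
      using \<open>ord_zero < \<gamma>\<close> by (subst (2) lessThan_limit[OF 3(2)]) blast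
    finally show ?thesis .
  qed
qed

lemma approx_mu_mono:
  assumes "mono F" "mono G" "\<And>A. F A \<subseteq> G A"
  shows "approx_mu F \<gamma> \<subseteq> approx_mu G \<gamma>"
proof (induction \<gamma> rule: less_induct)
  case (less \<gamma>)
  have "F (approx_mu F \<delta>) \<subseteq> G (approx_mu G \<delta>)" if "\<delta> < \<gamma>" for \<delta>
    using monoD[OF assms(1) less[OF that]] assms(3) by blast
  then show ?case
    unfolding approx_mu_unfold[OF assms(1), of \<gamma>] approx_mu_unfold[OF assms(2), of \<gamma>] by blast
qed

lemma approx_nu_mono:
  assumes "mono F" "mono G" "\<And>A. F A \<subseteq> G A" "\<And>A. G A \<subseteq> W"
  shows "approx_nu W F \<gamma> \<subseteq> approx_nu W G \<gamma>"
proof (induction \<gamma> rule: less_induct)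
  case (less \<gamma>)
  have *: "F A \<subseteq> W" for A
    using assms(3,4) by blast
  have "F (approx_nu W F \<delta>) \<subseteq> G (approx_nu W G \<delta>)" if "\<delta> < \<gamma>" for \<delta>
    using monoD[OF assms(1) less[OF that]] assms(3) by blast
  then show ?case
    unfolding approx_nu_unfold[OF assms(1) *, of \<gamma>] approx_nu_unfold[OF assms(2,4), of \<gamma>]
    by blast
qed


section \<open>Monotonicity of the compositional semantics\<close>

text \<open>The operator occurring in the \<open>Mu\<close> and \<open>Nu\<close> clauses of
  \<open>sat\<close>, named so that its approximants can be handled without unfolding it.\<close>

definition fix_op ::
  "('w, 'p) kripke \<Rightarrow> 'o::wellorder \<Rightarrow> ('x \<Rightarrow> 'w set) \<Rightarrow> 'x \<Rightarrow> ('p, 'x) fm \<Rightarrow> 'w set \<Rightarrow> 'w set"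
where
  "fix_op M \<Gamma> s X \<psi> = (\<lambda>A. {v \<in> worlds M. sat M \<Gamma> (s(X := A)) v \<psi>})"

lemma fix_op_subset: "fix_op M \<Gamma> s X \<psi> A \<subseteq> worlds M"
  by (auto simp: fix_op_def)

text \<open>Negation is applied to proposition symbols only, so every label occurs
  positively.\<close>

lemma sat_mono:
  assumes "\<And>X. s X \<subseteq> t X" "sat M \<Gamma> s w \<phi>"
  shows "sat M \<Gamma> t w \<phi>"
  using assms
proof (induction \<phi> arbitrary: s t w)
  case (Mu X \<phi>)
  \<comment> \<open>One inequality serves both needs of \<open>approx_mu_mono\<close>:
    \<open>u = v\<close> gives monotonicity of each operator, \<open>A = B\<close> the comparison of
    the two operators.\<close>
  have le: "fix_op M \<Gamma> u X \<phi> A \<subseteq> fix_op M \<Gamma> v X \<phi> B" if "\<And>Y. u Y \<subseteq> v Y" "A \<subseteq> B" for u v A B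
  proof -
    have "(u(X := A)) Y \<subseteq> (v(X := B)) Y" for Y
      using that by simp
    from Mu.IH[of "u(X := A)" "v(X := B)", OF this] show ?thesis
      unfolding fix_op_def by blast
  qed
  have "approx_mu (fix_op M \<Gamma> s X \<phi>) \<Gamma> \<subseteq> approx_mu (fix_op M \<Gamma> t X \<phi>) \<Gamma>"
    by (intro approx_mu_mono monoI le Mu.prems(1) order_refl) auto
  then show ?case using Mu.prems(2) by (auto simp: fix_op_def)
next
  case (Nu X \<phi>)
  have le: "fix_op M \<Gamma> u X \<phi> A \<subseteq> fix_op M \<Gamma> v X \<phi> B" if "\<And>Y. u Y \<subseteq> v Y" "A \<subseteq> B" for u v A B
  proof -
    have "(u(X := A)) Y \<subseteq> (v(X := B)) Y" for Y
      using that by simp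
    from Nu.IH[of "u(X := A)" "v(X := B)", OF this] show ?thesis
      unfolding fix_op_def by blast
  qed
  have "approx_nu (worlds M) (fix_op M \<Gamma> s X \<phi>) \<Gamma> \<subseteq> approx_nu (worlds M) (fix_op M \<Gamma> t X \<phi>) \<Gamma>"
    by (intro approx_nu_mono monoI le Nu.prems(1) order_refl fix_op_subset) auto
  then show ?case using Nu.prems(2) by (auto simp: fix_op_def)
qed (auto; blast)+

lemma mono_fix_op: "mono (fix_op M \<Gamma> s X \<psi>)"
proof (rule monoI)
  fix A B :: "'a set"
  assume "A \<subseteq> B"
  then have "(s(X := A)) Y \<subseteq> (s(X := B)) Y" for Y
    by simp
  from sat_mono[of "s(X := A)" "s(X := B)", OF this] show "fix_op M \<Gamma> s X \<psi> A \<subseteq> fix_op M \<Gamma> s X \<psi> B"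
    unfolding fix_op_def by blast
qed

text \<open>The right-hand side is the game rule in semantic form: pick \<delta> below the clock
  value and continue in the body with \<open>X\<close> read at index \<delta>.\<close>

lemma in_approx_mu_fix_op_iff:
  "w \<in> approx_mu (fix_op M \<Gamma> s X \<psi>) \<gamma> \<longleftrightarrow>
     w \<in> worlds M \<and> (\<exists>\<delta><\<gamma>. sat M \<Gamma> (s(X := approx_mu (fix_op M \<Gamma> s X \<psi>) \<delta>)) w \<psi>)"
  by (subst approx_mu_unfold[OF mono_fix_op]) (auto simp: fix_op_def)

lemma in_approx_nu_fix_op_iff:
  "w \<in> approx_nu (worlds M) (fix_op M \<Gamma> s X \<psi>) \<gamma> \<longleftrightarrow>
     w \<in> worlds M \<and>
     (\<forall>\<delta><\<gamma>. sat M \<Gamma> (s(X := approx_nu (worlds M) (fix_op M \<Gamma> s X \<psi>) \<delta>)) w \<psi>)"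
  by (subst approx_nu_unfold[OF mono_fix_op fix_op_subset]) (auto simp: fix_op_def)

lemma sat_Mu_fix_op: "sat M \<Gamma> s w (Mu X \<psi>) \<longleftrightarrow> w \<in> approx_mu (fix_op M \<Gamma> s X \<psi>) \<Gamma>"
  by (simp add: fix_op_def)

lemma sat_Nu_fix_op: "sat M \<Gamma> s w (Nu X \<psi>) \<longleftrightarrow> w \<in> approx_nu (worlds M) (fix_op M \<Gamma> s X \<psi>) \<Gamma>"
  by (simp add: fix_op_def)


section \<open>Nodes and binders\<close>

lemma subfm_at_append:
  "subfm_at \<phi> (n @ m) = (case subfm_at \<phi> n of None \<Rightarrow> None | Some \<psi> \<Rightarrow> subfm_at \<psi> m)"
  by (induction \<phi> n rule: subfm_at.induct) auto

lemma subfm_at_snoc: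
  "subfm_at \<phi> (n @ [i]) =
     (case subfm_at \<phi> n of None \<Rightarrow> None
      | Some \<psi> \<Rightarrow> if i < length (children \<psi>) then Some (children \<psi> ! i) else None)"
  by (auto simp: subfm_at_append split: option.split)

lemma size_children:
  assumes "i < length (children \<phi>)"
  shows "size (children \<phi> ! i) < size \<phi>"
  using assms by (cases \<phi>) (auto simp: less_Suc_eq)

text \<open>Supplies the fixed length of the lists that measure the progress of a play.\<close>

lemma length_node_less_size:
  assumes "n \<in> Sub \<phi>"
  shows "length n < size \<phi>"
  using assms
proof (induction \<phi> n rule: subfm_at.induct)
  case (1 \<phi>)
  then show ?case by (cases \<phi>) auto
next
  case (2 \<phi> i n)
  then show ?case
    using size_children[of i \<phi>] by (fastforce simp: Sub_def split: if_splits)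
qed

definition nearest_binder :: "('p, 'x) fm \<Rightarrow> node \<Rightarrow> 'x \<Rightarrow> node \<Rightarrow> bool" where
  "nearest_binder \<phi> n X r \<longleftrightarrow> strict_prefix r n \<and> (mu_at \<phi> r X \<or> nu_at \<phi> r X) \<and>
     (\<forall>r'. strict_prefix r r' \<and> strict_prefix r' n \<longrightarrow> \<not> (mu_at \<phi> r' X \<or> nu_at \<phi> r' X))"

text \<open>Two candidates are prefixes of the same node, hence comparable; were they distinct, the
  longer one would be a binder of \<open>X\<close> between the shorter one and
  \<open>n\<close>.\<close>

lemma rf_eq:
  assumes "nearest_binder \<phi> n X r"
  shows "rf \<phi> n X = r"
  unfolding rf_def
proof (rule the_equality)
  fix r'
  assume r': "strict_prefix r' n \<and> (mu_at \<phi> r' X \<or> nu_at \<phi> r' X) \<and>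
     (\<forall>r''. strict_prefix r' r'' \<and> strict_prefix r'' n \<longrightarrow> \<not> (mu_at \<phi> r'' X \<or> nu_at \<phi> r'' X))"
  then have "prefix r r' \<or> prefix r' r"
    using assms prefix_same_cases[of r n r'] unfolding nearest_binder_def strict_prefix_def by blast
  then show "r' = r"
    using assms r' unfolding nearest_binder_def by (metis strict_prefix_def)
qed (use assms in \<open>simp add: nearest_binder_def\<close>)

text \<open>
  Addresses are reversed so that the recursion runs from a node to its parent. The clock values at
  the binders above the node select the approximants.
\<close>

primrec rev_env ::
  "('w, 'p) kripke \<Rightarrow> 'o::wellorder \<Rightarrow> ('x \<Rightarrow> 'w set) \<Rightarrow> ('p, 'x) fm \<Rightarrow> (node \<Rightarrow> 'o) \<Rightarrow> node
     \<Rightarrow> ('x \<Rightarrow> 'w set)" where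
  "rev_env M \<Gamma> s \<phi> c [] = s"
| "rev_env M \<Gamma> s \<phi> c (i # m) =
     (let e = rev_env M \<Gamma> s \<phi> c m in
      case subfm_at \<phi> (rev m) of
        Some (Mu X \<psi>) \<Rightarrow> e(X := approx_mu (fix_op M \<Gamma> e X \<psi>) (c (rev m)))
      | Some (Nu X \<psi>) \<Rightarrow> e(X := approx_nu (worlds M) (fix_op M \<Gamma> e X \<psi>) (c (rev m)))
      | _ \<Rightarrow> e)"

definition env ::
  "('w, 'p) kripke \<Rightarrow> 'o::wellorder \<Rightarrow> ('x \<Rightarrow> 'w set) \<Rightarrow> ('p, 'x) fm \<Rightarrow> (node \<Rightarrow> 'o) \<Rightarrow> node
     \<Rightarrow> ('x \<Rightarrow> 'w set)" where
  "env M \<Gamma> s \<phi> c n = rev_env M \<Gamma> s \<phi> c (rev n)"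

lemma env_Nil [simp]: "env M \<Gamma> s \<phi> c [] = s"
  by (simp add: env_def)

lemma env_snoc:
  "env M \<Gamma> s \<phi> c (n @ [i]) =
     (case subfm_at \<phi> n of
        Some (Mu X \<psi>) \<Rightarrow>
          (env M \<Gamma> s \<phi> c n)(X := approx_mu (fix_op M \<Gamma> (env M \<Gamma> s \<phi> c n) X \<psi>) (c n))
      | Some (Nu X \<psi>) \<Rightarrow>
          (env M \<Gamma> s \<phi> c n)(X := approx_nu (worlds M) (fix_op M \<Gamma> (env M \<Gamma> s \<phi> c n) X \<psi>) (c n))
      | _ \<Rightarrow> env M \<Gamma> s \<phi> c n)"
  by (simp add: env_def Let_def split: option.split fm.split)

text \<open>Only clocks at strict ancestors are read, so choices made at \<open>n\<close> or below
  leave the environment at \<open>n\<close> intact.\<close>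

lemma env_cong:
  assumes "\<And>r. strict_prefix r n \<Longrightarrow> c r = d r"
  shows "env M \<Gamma> s \<phi> c n = env M \<Gamma> s \<phi> d n"
  using assms
proof (induction n rule: rev_induct)
  case (snoc i n)
  have "env M \<Gamma> s \<phi> c n = env M \<Gamma> s \<phi> d n"
    by (rule snoc.IH) (auto intro!: snoc.prems simp: strict_prefix_def)
  moreover have "c n = d n"
    by (rule snoc.prems) (simp add: strict_prefix_def)
  ultimately show ?case by (simp add: env_snoc split: option.split fm.split)
qed simp

text \<open>Climb from the occurrence towards the root. A node not binding \<open>X\<close> leaves
  its value unchanged and keeps it free in the larger formula; nothing is free at the root of a
  sentence, so a binder is met.\<close>

lemma env_bound_label:
  assumes "sentence \<phi>" "subfm_at \<phi> n = Some \<psi>" "X \<in> free_labels \<psi>"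
  shows "\<exists>r. nearest_binder \<phi> n X r \<and> env M \<Gamma> s \<phi> c n X = env M \<Gamma> s \<phi> c (r @ [0]) X"
  using assms(2,3)
proof (induction n arbitrary: \<psi> rule: rev_induct)
  case Nil
  then show ?case using assms(1) by (simp add: sentence_def)
next
  case (snoc i n)
  obtain \<theta> where \<theta>: "subfm_at \<phi> n = Some \<theta>" "i < length (children \<theta>)" "\<psi> = children \<theta> ! i"
    using snoc.prems(1) by (auto simp: subfm_at_snoc split: option.splits if_splits)
  show ?case
  proof (cases "mu_at \<phi> n X \<or> nu_at \<phi> n X")
    case True
    then have "nearest_binder \<phi> (n @ [i]) X n"
      by (auto simp: nearest_binder_def strict_prefix_def)
    \<comment> \<open>The update made on passing below a binder does not depend on the child
      index.\<close>
    moreover have "env M \<Gamma> s \<phi> c (n @ [i]) X = env M \<Gamma> s \<phi> c (n @ [0]) X"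
      by (simp add: env_snoc)
    ultimately show ?thesis by blast
  next
    case False
    have "X \<in> free_labels \<theta>"
      using False \<theta> snoc.prems(2)
      by (cases \<theta>) (auto simp: mu_at_def nu_at_def less_Suc_eq)
    with snoc.IH[OF \<theta>(1)] obtain r where
      r: "nearest_binder \<phi> n X r" "env M \<Gamma> s \<phi> c n X = env M \<Gamma> s \<phi> c (r @ [0]) X"
      by blast
    have "nearest_binder \<phi> (n @ [i]) X r"
      using r(1) False unfolding nearest_binder_def strict_prefix_def by auto
    moreover have "env M \<Gamma> s \<phi> c (n @ [i]) X = env M \<Gamma> s \<phi> c n X"
      using False \<theta>(1) by (auto simp: env_snoc mu_at_def nu_at_def split: fm.split)
    ultimately show ?thesis using r(2) by auto
  qed
qed


section \<open>The game\<close>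

text \<open>Criterion used for termination; \<open>k\<close> will be the first index at which the
  clock entries of the branch change.\<close>

lemma lexn_mapI:
  assumes "k < m" "\<And>i. i < k \<Longrightarrow> f i = g i" "(f k, g k) \<in> r"
  shows "(map f [0..<m], map g [0..<m]) \<in> lexn r m"
proof -
  have "[0..<m] = [0..<k] @ k # [Suc k..<m]"
    using upt_add_eq_append[of 0 k "m - k"] upt_conv_Cons[of k m] assms(1) by simp
  moreover have "map f [0..<k] = map g [0..<k]"
    using assms(2) by simp
  ultimately show ?thesis
    using assms(1,3) unfolding lexn_conv by fastforce
qed

locale evaluation_game =
  fixes M :: "('w, 'p) kripke" and \<Gamma> :: "'o::wellorder"
    and \<phi> :: "('p, 'x) fm" and s :: "'x \<Rightarrow> 'w set"
  assumes model: "kripke_model M" and sentence: "sentence \<phi>"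
begin

abbreviation e where "e \<equiv> env M \<Gamma> s \<phi>"

section \<open>Truth of positions and its behaviour under moves\<close>

fun true_at :: "('w, 'o) position \<Rightarrow> bool" where
  "true_at (w, n, c) \<longleftrightarrow> sat M \<Gamma> (e c n) w (the (subfm_at \<phi> n))"

lemma label_cases:
  assumes "subfm_at \<phi> n = Some (Var X)"
  obtains (mu) r \<psi> where "nearest_binder \<phi> n X r" "rf \<phi> n X = r" "subfm_at \<phi> r = Some (Mu X \<psi>)"
      "\<And>c. e c n X = approx_mu (fix_op M \<Gamma> (e c r) X \<psi>) (c r)"
  | (nu) r \<psi> where "nearest_binder \<phi> n X r" "rf \<phi> n X = r" "subfm_at \<phi> r = Some (Nu X \<psi>)"
      "\<And>c. e c n X = approx_nu (worlds M) (fix_op M \<Gamma> (e c r) X \<psi>) (c r)"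
proof -
  have ex: "\<exists>r. nearest_binder \<phi> n X r \<and> e c n X = e c (r @ [0]) X" for c
    by (rule env_bound_label[OF sentence assms]) simp
  let ?r = "rf \<phi> n X"
  \<comment> \<open>\<open>ex\<close> yields a binder for each \<open>c\<close> separately;
    \<open>rf_eq\<close> identifies them all with \<open>rf \<phi> n X\<close>, so one node serves
    every clock.\<close>
  have b: "nearest_binder \<phi> n X ?r" and eq: "e c n X = e c (?r @ [0]) X" for c
    using ex[of c] by (auto dest: rf_eq)
  from b consider \<psi> where "subfm_at \<phi> ?r = Some (Mu X \<psi>)" | \<psi> where "subfm_at \<phi> ?r = Some (Nu X \<psi>)"
    unfolding nearest_binder_def mu_at_def nu_at_def by blast
  then show thesis
  proof cases
    case 1
    show thesis by (rule mu[OF b refl 1]) (simp add: eq env_snoc 1)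
  next
    case 2
    show thesis by (rule nu[OF b refl 2]) (simp add: eq env_snoc 2)
  qed
qed

lemma env_upd: "e (c(n := \<gamma>)) n = e c n"
  by (rule env_cong) (auto simp: strict_prefix_def)

text \<open>A reset touches only \<open>r\<close> and nodes below it. Hence the approximant before
  and after a visit to a label belongs to the same operator; only its index drops.\<close>

lemma env_reset: "e (reset \<phi> \<Gamma> r \<gamma> c) r = e c r"
  by (rule env_cong) (auto simp: reset_def strict_prefix_def prefix_def)

lemma reset_same: "reset \<phi> \<Gamma> r \<gamma> c r = \<gamma>"
  by (simp add: reset_def)

lemma acc_worlds: "(w, v) \<in> acc M \<Longrightarrow> v \<in> worlds M"
  using model by (auto simp: kripke_model_def)

text \<open>The cases with content are \<open>Mu\<close> and a label bound by \<open>Mu\<close>,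
  where \<open>in_approx_mu_fix_op_iff\<close> turns membership in an approximant into a choice of
  index. At clock value zero both sides are false.\<close>

lemma true_at_eloise:
  assumes "P \<in> positions M \<phi> \<Gamma>" "eloise_moves \<phi> P"
  shows "true_at P \<longleftrightarrow> (\<exists>Q\<in>moves M \<phi> \<Gamma> P. true_at Q)"
proof -
  obtain w n c where P: "P = (w, n, c)" by (cases P)
  obtain \<psi> where \<psi>: "subfm_at \<phi> n = Some \<psi>" and w: "w \<in> worlds M"
    using assms(1) by (auto simp: P positions_def Sub_def)
  show ?thesis
  proof (cases \<psi>)
    case (Var X)
    with \<psi> have "subfm_at \<phi> n = Some (Var X)" by simp
    then show ?thesis
    proof (cases rule: label_cases)
      case (mu r \<theta>)
      then show ?thesis
        using \<psi> Var w
        by (auto simp: P Let_def subfm_at_snoc env_snoc env_reset reset_same in_approx_mu_fix_op_iff)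
    next
      case (nu r \<theta>)
      then show ?thesis
        using \<psi> Var assms(2) by (simp add: P eloise_moves_def mover_def mu_at_def nu_at_def)
    qed
  next
    case (Mu X \<theta>)
    then show ?thesis
      using \<psi> w
      by (auto simp: P subfm_at_snoc env_snoc env_upd sat_Mu_fix_op in_approx_mu_fix_op_iff
          simp del: sat.simps)
  qed (use \<psi> assms(2) in
      \<open>auto simp: P eloise_moves_def mover_def subfm_at_snoc env_snoc\<close>)
qed

text \<open>Dual argument through \<open>in_approx_nu_fix_op_iff\<close>; at a label with clock
  value zero both sides are true.\<close>

lemma true_at_abelard:
  assumes "P \<in> positions M \<phi> \<Gamma>" "mover \<phi> (fst (snd P)) = Some Abelard"
  shows "true_at P \<longleftrightarrow> (\<forall>Q\<in>moves M \<phi> \<Gamma> P. true_at Q)"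
proof -
  obtain w n c where P: "P = (w, n, c)" by (cases P)
  obtain \<psi> where \<psi>: "subfm_at \<phi> n = Some \<psi>" and w: "w \<in> worlds M"
    using assms(1) by (auto simp: P positions_def Sub_def)
  show ?thesis
  proof (cases \<psi>)
    case (Var X)
    with \<psi> have "subfm_at \<phi> n = Some (Var X)" by simp
    then show ?thesis
    proof (cases rule: label_cases)
      case (nu r \<theta>)
      then show ?thesis
        using \<psi> Var w
        by (auto simp: P Let_def subfm_at_snoc env_snoc env_reset reset_same in_approx_nu_fix_op_iff)
    next
      case (mu r \<theta>)
      then show ?thesis
        using \<psi> Var assms(2) by (simp add: P mover_def mu_at_def nu_at_def)
    qed
  next
    case (Nu X \<theta>)
    then show ?thesis
      using \<psi> w
      by (auto simp: P subfm_at_snoc env_snoc env_upd sat_Nu_fix_op in_approx_nu_fix_op_iff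
          simp del: sat.simps)
  qed (use \<psi> assms(2) in \<open>auto simp: P mover_def subfm_at_snoc env_snoc\<close>)
qed

text \<open>Only literals lack a mover: by \<open>label_cases\<close> every label in a sentence has
  a binder, and that binder determines a player.\<close>

lemma mover_None:
  assumes "P \<in> positions M \<phi> \<Gamma>" "mover \<phi> (fst (snd P)) = None"
  shows "moves M \<phi> \<Gamma> P = {}" "eloise_wins_at M \<phi> P \<longleftrightarrow> true_at P"
proof -
  obtain w n c where P: "P = (w, n, c)" by (cases P)
  obtain \<psi> where \<psi>: "subfm_at \<phi> n = Some \<psi>"
    using assms(1) by (auto simp: P positions_def Sub_def)
  have "\<psi> \<noteq> Var X" for X
  proof
    assume "\<psi> = Var X"
    then have v: "subfm_at \<phi> n = Some (Var X)" using \<psi> by simp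
    then show False
      by (cases rule: label_cases) (use v assms(2) in \<open>auto simp: P mover_def mu_at_def nu_at_def\<close>)
  qed
  then show "moves M \<phi> \<Gamma> P = {}" "eloise_wins_at M \<phi> P \<longleftrightarrow> true_at P"
    using \<psi> assms(2) by (cases \<psi>; simp add: P mover_def)+
qed

lemma eloise_wins_at_mover:
  assumes "mover \<phi> (fst (snd P)) = Some p"
  shows "eloise_wins_at M \<phi> P \<longleftrightarrow> p = Abelard"
  using assms by (cases P) (auto simp: mover_def split: option.splits fm.splits if_splits)

text \<open>Without moves the existential condition for Eloise fails and the universal one for
  Abelard holds, in agreement with the rule that a stuck player loses.\<close>

lemma true_at_terminal:
  assumes "P \<in> positions M \<phi> \<Gamma>" "moves M \<phi> \<Gamma> P = {}"
  shows "eloise_wins_at M \<phi> P \<longleftrightarrow> true_at P"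
proof (cases "mover \<phi> (fst (snd P))")
  case None
  then show ?thesis using mover_None assms(1) by blast
next
  case (Some p)
  then show ?thesis
    using assms true_at_eloise[of P] true_at_abelard[of P] eloise_wins_at_mover[OF Some]
    by (cases p) (auto simp: eloise_moves_def)
qed

lemma true_at_not_eloise:
  assumes "P \<in> positions M \<phi> \<Gamma>" "\<not> eloise_moves \<phi> P" "moves M \<phi> \<Gamma> P \<noteq> {}"
  shows "true_at P \<longleftrightarrow> (\<forall>Q\<in>moves M \<phi> \<Gamma> P. true_at Q)"
proof (cases "mover \<phi> (fst (snd P))")
  case None
  then show ?thesis using mover_None assms by blast
next
  case (Some p)
  then show ?thesis
    using assms true_at_abelard[of P] by (cases p) (auto simp: eloise_moves_def)
qed

section \<open>Shape and legality of moves\<close>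

lemma initial_in_positions:
  assumes "w \<in> worlds M"
  shows "initial_position w \<phi> \<Gamma> \<in> positions M \<phi> \<Gamma>"
  using assms by (auto simp: initial_position_def positions_def Sub_def)

text \<open>What termination needs to know about a move. A return to \<open>r\<close> resets only
  clocks below \<open>r\<close>, so the clocks above \<open>r\<close> survive.\<close>

lemma moves_cases:
  assumes "(w, n, c) \<in> positions M \<phi> \<Gamma>" "(w', n', c') \<in> moves M \<phi> \<Gamma> (w, n, c)"
  obtains (down) i where "n' = n @ [i]" "\<And>r. r \<noteq> n \<Longrightarrow> c' r = c r"
  | (return) r where "strict_prefix r n" "n' = r @ [0]" "c' r < c r"
      "\<And>r'. strict_prefix r' r \<Longrightarrow> c' r' = c r'"
proof -
  obtain \<psi> where \<psi>: "subfm_at \<phi> n = Some \<psi>"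
    using assms(1) by (auto simp: positions_def Sub_def)
  show thesis
  proof (cases \<psi>)
    case (Var X)
    then have v: "subfm_at \<phi> n = Some (Var X)" using \<psi> by simp
    have "nearest_binder \<phi> n X (rf \<phi> n X)"
      using v by (cases rule: label_cases) auto
    with v assms(2) show thesis
      by (intro return[of "rf \<phi> n X"])
        (auto simp: nearest_binder_def reset_def Let_def strict_prefix_def prefix_def)
  qed (use assms(2) \<psi> down in auto)
qed

lemma moves_in_positions:
  assumes "P \<in> positions M \<phi> \<Gamma>" "Q \<in> moves M \<phi> \<Gamma> P"
  shows "Q \<in> positions M \<phi> \<Gamma>"
proof -
  obtain w n c where P: "P = (w, n, c)" by (cases P)
  obtain \<psi> where \<psi>: "subfm_at \<phi> n = Some \<psi>"
    using assms(1) by (auto simp: P positions_def Sub_def)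
  have w: "w \<in> worlds M" and c: "c \<in> Sub_munu \<phi> \<rightarrow>\<^sub>E {..\<Gamma>}"
    using assms(1) by (auto simp: P positions_def)
  have upd: "c(n := \<gamma>) \<in> Sub_munu \<phi> \<rightarrow>\<^sub>E {..\<Gamma>}" if "\<gamma> < \<Gamma>" "n \<in> Sub_munu \<phi>" for \<gamma>
    using PiE_fun_upd[OF _ c, of \<gamma> n] that by (simp add: insert_absorb)
  show ?thesis
  proof (cases \<psi>)
    case (Var X)
    then have v: "subfm_at \<phi> n = Some (Var X)" using \<psi> by simp
    let ?r = "rf \<phi> n X"
    have r: "?r \<in> Sub_munu \<phi>" "?r @ [0] \<in> Sub \<phi>"
      using v by (cases rule: label_cases;
          auto simp: Sub_munu_def mu_at_def nu_at_def Sub_def subfm_at_snoc)+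
    obtain \<gamma> where \<gamma>: "Q = (w, ?r @ [0], reset \<phi> \<Gamma> ?r \<gamma> c)" "\<gamma> < c ?r"
      using assms(2) v by (auto simp: P Let_def)
    have "c ?r \<le> \<Gamma>" using c r(1) by auto
    with \<gamma>(2) have "\<gamma> \<le> \<Gamma>" by simp
    \<comment> \<open>\<open>reset\<close> changes values at fixpoint nodes only, so the clock
      remains \<open>undefined\<close> elsewhere.\<close>
    then have "reset \<phi> \<Gamma> ?r \<gamma> c \<in> Sub_munu \<phi> \<rightarrow>\<^sub>E {..\<Gamma>}"
      using c r(1) by (auto simp: reset_def PiE_iff extensional_def)
    with \<gamma>(1) r(2) w show ?thesis by (simp add: positions_def)
  next
    case (Mu X \<theta>)
    with \<psi> have "n \<in> Sub_munu \<phi>" by (auto simp: Sub_munu_def mu_at_def)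
    then show ?thesis
      using assms(2) \<psi> Mu w upd by (auto simp: P positions_def Sub_def subfm_at_snoc)
  next
    case (Nu X \<theta>)
    with \<psi> have "n \<in> Sub_munu \<phi>" by (auto simp: Sub_munu_def nu_at_def)
    then show ?thesis
      using assms(2) \<psi> Nu w upd by (auto simp: P positions_def Sub_def subfm_at_snoc)
  qed (use assms(2) \<psi> c w in
      \<open>auto simp: P positions_def Sub_def subfm_at_snoc acc_worlds\<close>)
qed

section \<open>Termination of plays\<close>

text \<open>
  The clock values on the branch to \<open>n\<close>, padded to a fixed length by entries larger than all clock
  values, so that a step down is a decrease.
\<close>

definition branch :: "node \<Rightarrow> (node \<Rightarrow> 'o) \<Rightarrow> nat \<Rightarrow> nat \<times> 'o" where
  "branch n c i = (if i < length n then (0, c (take i n)) else (1, ord_zero))"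

definition entry_less :: "((nat \<times> 'o) \<times> (nat \<times> 'o)) set" where
  "entry_less = less_than <*lex*> {(\<gamma>, \<delta>). \<gamma> < \<delta>}"

text \<open>A step down replaces the padding at index \<open>length n\<close> by a clock value. A
  return to \<open>r\<close> lowers the entry at index \<open>length r\<close>; the later entries
  become padding, but they come after the first difference.\<close>

lemma branch_decreases:
  assumes "(w, n, c) \<in> positions M \<phi> \<Gamma>" "(w', n', c') \<in> moves M \<phi> \<Gamma> (w, n, c)"
  shows "(map (branch n' c') [0..<size \<phi>], map (branch n c) [0..<size \<phi>]) \<in> lexn entry_less (size \<phi>)"
proof -
  have n: "length n < size \<phi>"
    using assms(1) length_node_less_size[of n \<phi>] by (simp add: positions_def)
  show ?thesis
    using assms
  proof (cases rule: moves_cases)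
    case (down i)
    \<comment> \<open>The move may set the clock of \<open>n\<close> itself, but that entry sits at
      index \<open>length n\<close>; proper prefixes of \<open>n\<close> keep their values.\<close>
    have "branch n' c' j = branch n c j" if "j < length n" for j
    proof -
      have "take j n \<noteq> n" using that by (metis length_take min.absorb4 nat_neq_iff)
      with that down show ?thesis by (simp add: branch_def)
    qed
    with n down show ?thesis
      by (intro lexn_mapI[of "length n"]) (auto simp: branch_def entry_less_def)
  next
    case (return r)
    obtain m where m: "n = r @ m" "m \<noteq> []"
      using return(1) by (auto simp: strict_prefix_def prefix_def)
    have "strict_prefix (take j r) r" if "j < length r" for j
      using that by (metis length_take min.absorb4 nat_neq_iff strict_prefix_def take_is_prefix)
    then have "branch n' c' j = branch n c j" if "j < length r" for j
      using that return m by (simp add: branch_def)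
    moreover have "(branch n' c' (length r), branch n c (length r)) \<in> entry_less"
      using return m by (simp add: branch_def entry_less_def)
    ultimately show ?thesis
      using n m by (intro lexn_mapI[of "length r"]) auto
  qed
qed

text \<open>All lists have length \<open>size \<phi>\<close>, and \<open>lexn\<close> at a fixed
  length inherits well-foundedness from \<open>entry_less\<close>.\<close>

lemma no_infinite_play:
  assumes "\<pi> 0 \<in> positions M \<phi> \<Gamma>" "\<And>i. \<pi> (Suc i) \<in> moves M \<phi> \<Gamma> (\<pi> i)"
  shows False
proof -
  have pos: "\<pi> i \<in> positions M \<phi> \<Gamma>" for i
    by (induction i) (use assms moves_in_positions in blast)+
  define f where "f i = map (branch (fst (snd (\<pi> i))) (snd (snd (\<pi> i)))) [0..<size \<phi>]" for i
  have "(f (Suc i), f i) \<in> lexn entry_less (size \<phi>)" for i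
    using branch_decreases[of "fst (\<pi> i)" "fst (snd (\<pi> i))" "snd (snd (\<pi> i))"
        "fst (\<pi> (Suc i))" "fst (snd (\<pi> (Suc i)))" "snd (snd (\<pi> (Suc i)))"]
      pos[of i] assms(2)[of i] by (simp add: f_def)
  moreover have "wf (lexn entry_less (size \<phi>))"
    unfolding entry_less_def by (intro wf_lexn wf_lex_prod wf_less_than wf)
  ultimately show False
    unfolding wf_iff_no_infinite_down_chain by blast
qed

section \<open>Compositional truth and winning strategies\<close>

lemma true_at_initial: "true_at (initial_position w \<phi> \<Gamma>) \<longleftrightarrow> sat M \<Gamma> s w \<phi>"
  by (simp add: initial_position_def)

lemma game_true_if_sat:
  assumes "w \<in> worlds M" "sat M \<Gamma> s w \<phi>"
  shows "game_true M \<Gamma> w \<phi>"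
proof -
  \<comment> \<open>Move to a true position if there is one. The fallback to an arbitrary move is
    there because \<open>strategy\<close> demands a legal choice at false positions too.\<close>
  define \<sigma> where "\<sigma> P = (if \<exists>Q\<in>moves M \<phi> \<Gamma> P. true_at Q
      then SOME Q. Q \<in> moves M \<phi> \<Gamma> P \<and> true_at Q else SOME Q. Q \<in> moves M \<phi> \<Gamma> P)" for P
  have \<sigma>_true: "\<sigma> P \<in> moves M \<phi> \<Gamma> P \<and> true_at (\<sigma> P)"
    if ex: "\<exists>Q\<in>moves M \<phi> \<Gamma> P. true_at Q" for P
  proof -
    from ex have "\<exists>Q. Q \<in> moves M \<phi> \<Gamma> P \<and> true_at Q" by blast
    from someI_ex[OF this] show ?thesis unfolding \<sigma>_def if_P[OF ex] .
  qed
  have \<sigma>_move: "\<sigma> P \<in> moves M \<phi> \<Gamma> P" if "moves M \<phi> \<Gamma> P \<noteq> {}" for P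
  proof (cases "\<exists>Q\<in>moves M \<phi> \<Gamma> P. true_at Q")
    case False
    then have "\<sigma> P = (SOME Q. Q \<in> moves M \<phi> \<Gamma> P)" unfolding \<sigma>_def by (rule if_not_P)
    then show ?thesis using some_in_eq[of "moves M \<phi> \<Gamma> P"] that by simp
  qed (use \<sigma>_true in blast)
  have "eloise_wins_play M \<phi> p" if play: "is_play M w \<phi> \<Gamma> p" and foll: "follows \<phi> \<sigma> p" for p
  proof (cases p)
    case (Finite ps)
    have "i < length ps \<Longrightarrow> ps ! i \<in> positions M \<phi> \<Gamma> \<and> true_at (ps ! i)" for i
    proof (induction i)
      case 0
      then show ?case
        using play assms Finite initial_in_positions true_at_initial by (auto simp: hd_conv_nth)
    next
      case (Suc i)
      then have pos: "ps ! i \<in> positions M \<phi> \<Gamma>" and tr: "true_at (ps ! i)" by auto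
      have mv: "ps ! Suc i \<in> moves M \<phi> \<Gamma> (ps ! i)" using play Suc.prems Finite by auto
      have "true_at (ps ! Suc i)"
      proof (cases "eloise_moves \<phi> (ps ! i)")
        case True
        then show ?thesis
          using true_at_eloise[OF pos] tr \<sigma>_true foll Suc.prems Finite by auto
      next
        case False
        then show ?thesis using true_at_not_eloise[OF pos] tr mv by auto
      qed
      then show ?case using moves_in_positions[OF pos mv] by blast
    qed
    moreover have "ps \<noteq> []" "moves M \<phi> \<Gamma> (last ps) = {}" using play Finite by auto
    ultimately show ?thesis
      using true_at_terminal[of "last ps"] Finite by (simp add: last_conv_nth)
  next
    case (Infinite \<pi>)
    then show ?thesis
      using play no_infinite_play[of \<pi>] initial_in_positions[OF assms(1)] by auto
  qed
  then have "winning_strategy M w \<phi> \<Gamma> \<sigma>"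
    using \<sigma>_move by (auto simp: winning_strategy_def strategy_def)
  then show ?thesis by (auto simp: game_true_def)
qed

lemma sat_if_game_true:
  assumes "w \<in> worlds M" "game_true M \<Gamma> w \<phi>"
  shows "sat M \<Gamma> s w \<phi>"
proof (rule ccontr)
  assume "\<not> sat M \<Gamma> s w \<phi>"
  then have init: "\<not> true_at (initial_position w \<phi> \<Gamma>)" by (simp add: true_at_initial)
  obtain \<sigma> where \<sigma>: "strategy M \<phi> \<Gamma> \<sigma>"
    and win: "\<And>p. is_play M w \<phi> \<Gamma> p \<Longrightarrow> follows \<phi> \<sigma> p \<Longrightarrow> eloise_wins_play M \<phi> p"
    using assms(2) by (auto simp: game_true_def winning_strategy_def)
  \<comment> \<open>One round against \<sigma>: Eloise obeys \<sigma>, Abelard picks a false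
    successor. Iterating \<open>g\<close> produces a single run consistent with \<sigma>.\<close>
  define g where "g P = (if eloise_moves \<phi> P then \<sigma> P
      else SOME Q. Q \<in> moves M \<phi> \<Gamma> P \<and> \<not> true_at Q)" for P
  define \<pi> where "\<pi> i = (g ^^ i) (initial_position w \<phi> \<Gamma>)" for i
  have step: "g P \<in> moves M \<phi> \<Gamma> P \<and> \<not> true_at (g P)"
    if P: "P \<in> positions M \<phi> \<Gamma>" "\<not> true_at P" "moves M \<phi> \<Gamma> P \<noteq> {}" for P
  proof (cases "eloise_moves \<phi> P")
    case True
    then have "\<sigma> P \<in> moves M \<phi> \<Gamma> P" using \<sigma> P by (auto simp: strategy_def)
    then show ?thesis using true_at_eloise[OF P(1) True] P(2) True by (auto simp: g_def)
  next
    case False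
    then have "\<exists>Q. Q \<in> moves M \<phi> \<Gamma> P \<and> \<not> true_at Q"
      using true_at_not_eloise[OF P(1) False P(3)] P(2) by blast
    from someI_ex[OF this] False show ?thesis by (simp add: g_def)
  qed
  have \<pi>0: "\<pi> 0 = initial_position w \<phi> \<Gamma>" and \<pi>Suc: "\<pi> (Suc i) = g (\<pi> i)" for i
    by (simp_all add: \<pi>_def)
  \<comment> \<open>\<pi> is total, but its values carry meaning only up to the first position
    without moves.\<close>
  have inv: "(\<forall>j<i. moves M \<phi> \<Gamma> (\<pi> j) \<noteq> {}) \<Longrightarrow> \<pi> i \<in> positions M \<phi> \<Gamma> \<and> \<not> true_at (\<pi> i)" for i
  proof (induction i)
    case 0
    then show ?case using init initial_in_positions[OF assms(1)] by (simp add: \<pi>0)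
  next
    case (Suc i)
    then show ?case using step[of "\<pi> i"] moves_in_positions[of "\<pi> i"] by (simp add: \<pi>Suc)
  qed
  show False
  proof (cases "\<forall>i. moves M \<phi> \<Gamma> (\<pi> i) \<noteq> {}")
    case True
    \<comment> \<open>Such a run would be an infinite play following \<sigma>, which
      \<open>win\<close> would award to Eloise, although no infinite play is hers.\<close>
    then have "is_play M w \<phi> \<Gamma> (Infinite \<pi>)" "follows \<phi> \<sigma> (Infinite \<pi>)"
      using inv step by (auto simp: \<pi>0 \<pi>Suc) (simp add: g_def)
    then show False using win by fastforce
  next
    case False
    \<comment> \<open>Cutting the run at its first position without moves gives a maximal play; it
      ends in the false position \<open>\<pi> k\<close>, which Eloise loses.\<close>
    define k where "k = (LEAST k. moves M \<phi> \<Gamma> (\<pi> k) = {})"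
    have k: "moves M \<phi> \<Gamma> (\<pi> k) = {}" unfolding k_def by (rule LeastI_ex) (use False in blast)
    have ne: "moves M \<phi> \<Gamma> (\<pi> i) \<noteq> {}" if "i < k" for i
      using that not_less_Least unfolding k_def by blast
    let ?ps = "map \<pi> [0..<Suc k]"
    have nth: "?ps ! i = \<pi> i" if "i \<le> k" for i
      using that by (simp add: nth_map_upt del: upt_Suc)
    have last: "last ?ps = \<pi> k" by simp
    have hd: "hd ?ps = \<pi> 0" by (simp add: hd_map del: upt_Suc)
    have "\<pi> (Suc i) \<in> moves M \<phi> \<Gamma> (\<pi> i)" if "i < k" for i
      using inv[of i] ne step[of "\<pi> i"] that by (simp add: \<pi>Suc)
    then have "is_play M w \<phi> \<Gamma> (Finite ?ps)"
      using k nth last hd by (simp add: \<pi>0 del: upt_Suc)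
    moreover have "follows \<phi> \<sigma> (Finite ?ps)"
      using nth by (auto simp: \<pi>Suc g_def simp del: upt_Suc)
    ultimately have "eloise_wins_at M \<phi> (\<pi> k)"
      using win last by fastforce
    then show False
      using true_at_terminal[OF _ k] inv[of k] ne by blast
  qed
qed

end

theorem theorem11:
  fixes M :: "('w, 'p) kripke" and \<Gamma> :: "'o::wellorder"
    and \<phi>\<^sub>0 :: "('p, 'x) fm" and s :: "'x \<Rightarrow> 'w set" and w\<^sub>0 :: 'w
  assumes "kripke_model M" and "w\<^sub>0 \<in> worlds M" and "ord_zero < \<Gamma>"
    and "sentence \<phi>\<^sub>0" and "assignment M s"
  shows "sat M \<Gamma> s w\<^sub>0 \<phi>\<^sub>0 \<longleftrightarrow> game_true M \<Gamma> w\<^sub>0 \<phi>\<^sub>0"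
proof -
  interpret evaluation_game M \<Gamma> \<phi>\<^sub>0 s
    using assms by unfold_locales
  show ?thesis
    using game_true_if_sat sat_if_game_true assms(2) by blast
qed

end
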